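(* Let $\mathcal U$ be a universe and let $\operatorname{D}:\mathcal U\to\mathcal U$ be a type family such that (a) for every $X:\mathcal U$ there is a map $\operatorname{D}(X)\to\operatorname{isProp}(X)$, and (b) $\operatorname{D}$ has conditional conjunction: for all $P,Q:\mathcal U$ there is a map $\operatorname{D}(P)\to(P\to\operatorname{D}(Q))\to\operatorname{D}(P\times Q)$. Define $\operatorname{d}(X):=\lVert \operatorname{D}(X)\rVert$. Then the following are logically equivalent: (1) for all $X,Y:\mathcal U$, $\operatorname{D}(X)\to\big(X\to\lVert\operatorname{D}(Y)\rVert\big)\to\big\lVert X\to\operatorname{D}(Y)\big\rVert$; (2) $\operatorname{d}$ satisfies the dominance axiom: for all $P,Q:\mathcal U$, $\operatorname{d}(P)\to(P\to\operatorname{d}(Q))\to\operatorname{d}(P\times Q)$.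
   Context: We work in Martin-Löf type theory with a universe $\mathcal U$, assuming function extensionality, proposition extensionality (logically equivalent propositions are equal) and propositional truncation: for each type $X$ a proposition $\lVert X\rVert$ with a map $|{-}|:X\to\lVert X\rVert$ through which every map from $X$ to a proposition factors uniquely. A type $P$ is a proposition ($\operatorname{isProp}(P)$) if any two of its elements are equal. *)

theory Defs
  imports Main
begin

text \<open>
  The statement is a claim of derivability inside Martin-Loef type theory.  HOL itself is classical
  and has choice, so reading the types involved as HOL propositions or sets would trivialise it;
  the type theory is therefore given here as a deductive system.

  Terms and types share one syntax with de Bruijn indices (Russell-style universe).
  Binding structure: \<open>Pi A B\<close>, \<open>Sig A B\<close> and \<open>Lam A b\<close> bind one variable in their second argument.
  In the eliminators the motive \<open>C\<close> binds the eliminated element (in \<open>EqInd\<close>: the two endpoints and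
  the path); the branches bind two variables in \<open>SigInd\<close> (the components) and in the successor
  branch of \<open>NNInd\<close> (predecessor, then inductive hypothesis), one variable in \<open>EqInd\<close> and in both
  branches of \<open>PlusInd\<close>, and none elsewhere.
\<close>

datatype tm =
    Var nat
  | U
  | Pi tm tm | Lam tm tm | App tm tm  (infixl \<open>\<^bold>\<cdot>\<close> 90)
  | Sig tm tm | Pr tm tm | SigInd tm tm tm
  | Eq tm tm tm | Refl tm | EqInd tm tm tm tm tm
  | Empty | EmptyInd tm tm
  | One | Star | OneInd tm tm tm
  | Plus tm tm | InL tm | InR tm | PlusInd tm tm tm tm
  | NN | Zero | Succ tm | NNInd tm tm tm tm
  | Trunc tm | Tr tm | TrEq tm tm | TrRec tm tm tm tm
  | FunExt tm tm tm
  | PropExt tm tm tm tm tm tm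

primrec upr :: "(nat \<Rightarrow> nat) \<Rightarrow> nat \<Rightarrow> nat" where
  "upr r 0 = 0"
| "upr r (Suc n) = Suc (r n)"

primrec ren :: "(nat \<Rightarrow> nat) \<Rightarrow> tm \<Rightarrow> tm" where
  "ren r (Var n) = Var (r n)"
| "ren r U = U"
| "ren r (Pi A B) = Pi (ren r A) (ren (upr r) B)"
| "ren r (Lam A b) = Lam (ren r A) (ren (upr r) b)"
| "ren r (App f a) = App (ren r f) (ren r a)"
| "ren r (Sig A B) = Sig (ren r A) (ren (upr r) B)"
| "ren r (Pr a b) = Pr (ren r a) (ren r b)"
| "ren r (SigInd C g p) = SigInd (ren (upr r) C) (ren (upr (upr r)) g) (ren r p)"
| "ren r (Eq A a b) = Eq (ren r A) (ren r a) (ren r b)"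
| "ren r (Refl a) = Refl (ren r a)"
| "ren r (EqInd C c a b p) =
     EqInd (ren (upr (upr (upr r))) C) (ren (upr r) c) (ren r a) (ren r b) (ren r p)"
| "ren r Empty = Empty"
| "ren r (EmptyInd C t) = EmptyInd (ren (upr r) C) (ren r t)"
| "ren r One = One"
| "ren r Star = Star"
| "ren r (OneInd C c t) = OneInd (ren (upr r) C) (ren r c) (ren r t)"
| "ren r (Plus A B) = Plus (ren r A) (ren r B)"
| "ren r (InL a) = InL (ren r a)"
| "ren r (InR b) = InR (ren r b)"
| "ren r (PlusInd C c d t) =
     PlusInd (ren (upr r) C) (ren (upr r) c) (ren (upr r) d) (ren r t)"
| "ren r NN = NN"
| "ren r Zero = Zero"
| "ren r (Succ n) = Succ (ren r n)"
| "ren r (NNInd C c d n) =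
     NNInd (ren (upr r) C) (ren r c) (ren (upr (upr r)) d) (ren r n)"
| "ren r (Trunc A) = Trunc (ren r A)"
| "ren r (Tr a) = Tr (ren r a)"
| "ren r (TrEq x y) = TrEq (ren r x) (ren r y)"
| "ren r (TrRec B p f t) = TrRec (ren r B) (ren r p) (ren r f) (ren r t)"
| "ren r (FunExt f g h) = FunExt (ren r f) (ren r g) (ren r h)"
| "ren r (PropExt P Q p q f g) =
     PropExt (ren r P) (ren r Q) (ren r p) (ren r q) (ren r f) (ren r g)"

abbreviation wk :: "tm \<Rightarrow> tm" where
  "wk \<equiv> ren Suc"

primrec scons :: "tm \<Rightarrow> (nat \<Rightarrow> tm) \<Rightarrow> nat \<Rightarrow> tm"  (infixr \<open>##\<close> 65) where
  "(a ## s) 0 = a"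
| "(a ## s) (Suc n) = s n"

abbreviation ups :: "(nat \<Rightarrow> tm) \<Rightarrow> nat \<Rightarrow> tm" where
  "ups s \<equiv> Var 0 ## (\<lambda>n. wk (s n))"

primrec sub :: "(nat \<Rightarrow> tm) \<Rightarrow> tm \<Rightarrow> tm" where
  "sub s (Var n) = s n"
| "sub s U = U"
| "sub s (Pi A B) = Pi (sub s A) (sub (ups s) B)"
| "sub s (Lam A b) = Lam (sub s A) (sub (ups s) b)"
| "sub s (App f a) = App (sub s f) (sub s a)"
| "sub s (Sig A B) = Sig (sub s A) (sub (ups s) B)"
| "sub s (Pr a b) = Pr (sub s a) (sub s b)"
| "sub s (SigInd C g p) = SigInd (sub (ups s) C) (sub (ups (ups s)) g) (sub s p)"
| "sub s (Eq A a b) = Eq (sub s A) (sub s a) (sub s b)"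
| "sub s (Refl a) = Refl (sub s a)"
| "sub s (EqInd C c a b p) =
     EqInd (sub (ups (ups (ups s))) C) (sub (ups s) c) (sub s a) (sub s b) (sub s p)"
| "sub s Empty = Empty"
| "sub s (EmptyInd C t) = EmptyInd (sub (ups s) C) (sub s t)"
| "sub s One = One"
| "sub s Star = Star"
| "sub s (OneInd C c t) = OneInd (sub (ups s) C) (sub s c) (sub s t)"
| "sub s (Plus A B) = Plus (sub s A) (sub s B)"
| "sub s (InL a) = InL (sub s a)"
| "sub s (InR b) = InR (sub s b)"
| "sub s (PlusInd C c d t) =
     PlusInd (sub (ups s) C) (sub (ups s) c) (sub (ups s) d) (sub s t)"
| "sub s NN = NN"
| "sub s Zero = Zero"
| "sub s (Succ n) = Succ (sub s n)"
| "sub s (NNInd C c d n) =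
     NNInd (sub (ups s) C) (sub s c) (sub (ups (ups s)) d) (sub s n)"
| "sub s (Trunc A) = Trunc (sub s A)"
| "sub s (Tr a) = Tr (sub s a)"
| "sub s (TrEq x y) = TrEq (sub s x) (sub s y)"
| "sub s (TrRec B p f t) = TrRec (sub s B) (sub s p) (sub s f) (sub s t)"
| "sub s (FunExt f g h) = FunExt (sub s f) (sub s g) (sub s h)"
| "sub s (PropExt P Q p q f g) =
     PropExt (sub s P) (sub s Q) (sub s p) (sub s q) (sub s f) (sub s g)"

text \<open>\<open>B[a]\<close>: instantiation of the last variable of the context.\<close>

abbreviation inst :: "tm \<Rightarrow> tm \<Rightarrow> tm" where
  "inst B a \<equiv> sub (a ## Var) B"

definition arr :: "tm \<Rightarrow> tm \<Rightarrow> tm"  (infixr \<open>\<^bold>\<rightarrow>\<close> 60) where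
  "A \<^bold>\<rightarrow> B = Pi A (wk B)"

definition times :: "tm \<Rightarrow> tm \<Rightarrow> tm"  (infixr \<open>\<^bold>\<times>\<close> 70) where
  "A \<^bold>\<times> B = Sig A (wk B)"

definition is_prop :: "tm \<Rightarrow> tm" where
  "is_prop A = Pi A (Pi (wk A) (Eq (wk (wk A)) (Var 1) (Var 0)))"

text \<open>
  A context lists the types of its variables, most recent first.  All judgement forms are defined
  simultaneously, with typed judgemental equality.  Types need not lie in \<open>U\<close>: this is where
  quantification over all \<open>X : U\<close> lives.

  The truncation of \<open>A\<close> is a proposition (\<open>TrEq\<close>) with a map \<open>Tr\<close> from \<open>A\<close> through which maps to
  propositions factor (\<open>TrRec\<close>).  No computation rule is postulated: that the factorisation
  commutes and is unique holds up to identity because the target is a proposition.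
\<close>

type_synonym ctxt = "tm list"

inductive
      is_ctx :: "ctxt \<Rightarrow> bool"  (\<open>_ ctx\<close> [51] 50)
  and is_type :: "ctxt \<Rightarrow> tm \<Rightarrow> bool"  (\<open>_ \<turnstile> _ ty\<close> [51, 51] 50)
  and eq_type :: "ctxt \<Rightarrow> tm \<Rightarrow> tm \<Rightarrow> bool"  (\<open>_ \<turnstile> _ \<^bold>= _ ty\<close> [51, 51, 51] 50)
  and has_type :: "ctxt \<Rightarrow> tm \<Rightarrow> tm \<Rightarrow> bool"  (\<open>_ \<turnstile> _ \<^bold>: _\<close> [51, 51, 51] 50)
  and eq_term :: "ctxt \<Rightarrow> tm \<Rightarrow> tm \<Rightarrow> tm \<Rightarrow> bool"  (\<open>_ \<turnstile> _ \<^bold>= _ \<^bold>: _\<close> [51, 51, 51, 51] 50)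
where
  ctx_Nil: "[] ctx"
| ctx_Cons: "\<lbrakk>\<Gamma> ctx; \<Gamma> \<turnstile> A ty\<rbrakk> \<Longrightarrow> (A # \<Gamma>) ctx"
| tm_Var: "\<lbrakk>\<Gamma> ctx; i < length \<Gamma>\<rbrakk> \<Longrightarrow> \<Gamma> \<turnstile> Var i \<^bold>: ren (\<lambda>n. n + Suc i) (\<Gamma> ! i)"

| eqty_refl: "\<Gamma> \<turnstile> A ty \<Longrightarrow> \<Gamma> \<turnstile> A \<^bold>= A ty"
| eqty_sym: "\<Gamma> \<turnstile> A \<^bold>= B ty \<Longrightarrow> \<Gamma> \<turnstile> B \<^bold>= A ty"
| eqty_trans: "\<lbrakk>\<Gamma> \<turnstile> A \<^bold>= B ty; \<Gamma> \<turnstile> B \<^bold>= C ty\<rbrakk> \<Longrightarrow> \<Gamma> \<turnstile> A \<^bold>= C ty"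
| eqtm_refl: "\<Gamma> \<turnstile> a \<^bold>: A \<Longrightarrow> \<Gamma> \<turnstile> a \<^bold>= a \<^bold>: A"
| eqtm_sym: "\<Gamma> \<turnstile> a \<^bold>= b \<^bold>: A \<Longrightarrow> \<Gamma> \<turnstile> b \<^bold>= a \<^bold>: A"
| eqtm_trans: "\<lbrakk>\<Gamma> \<turnstile> a \<^bold>= b \<^bold>: A; \<Gamma> \<turnstile> b \<^bold>= c \<^bold>: A\<rbrakk> \<Longrightarrow> \<Gamma> \<turnstile> a \<^bold>= c \<^bold>: A"
| tm_conv: "\<lbrakk>\<Gamma> \<turnstile> a \<^bold>: A; \<Gamma> \<turnstile> A \<^bold>= B ty\<rbrakk> \<Longrightarrow> \<Gamma> \<turnstile> a \<^bold>: B"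
| eqtm_conv: "\<lbrakk>\<Gamma> \<turnstile> a \<^bold>= b \<^bold>: A; \<Gamma> \<turnstile> A \<^bold>= B ty\<rbrakk> \<Longrightarrow> \<Gamma> \<turnstile> a \<^bold>= b \<^bold>: B"

| ty_U: "\<Gamma> ctx \<Longrightarrow> \<Gamma> \<turnstile> U ty"
| ty_El: "\<Gamma> \<turnstile> A \<^bold>: U \<Longrightarrow> \<Gamma> \<turnstile> A ty"
| eqty_El: "\<Gamma> \<turnstile> A \<^bold>= B \<^bold>: U \<Longrightarrow> \<Gamma> \<turnstile> A \<^bold>= B ty"

| ty_Pi: "\<lbrakk>\<Gamma> \<turnstile> A ty; A # \<Gamma> \<turnstile> B ty\<rbrakk> \<Longrightarrow> \<Gamma> \<turnstile> Pi A B ty"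
| eqty_Pi: "\<lbrakk>\<Gamma> \<turnstile> A ty; \<Gamma> \<turnstile> A \<^bold>= A' ty; A # \<Gamma> \<turnstile> B \<^bold>= B' ty\<rbrakk> \<Longrightarrow> \<Gamma> \<turnstile> Pi A B \<^bold>= Pi A' B' ty"
| tm_Pi: "\<lbrakk>\<Gamma> \<turnstile> A \<^bold>: U; A # \<Gamma> \<turnstile> B \<^bold>: U\<rbrakk> \<Longrightarrow> \<Gamma> \<turnstile> Pi A B \<^bold>: U"
| eqtm_Pi: "\<lbrakk>\<Gamma> \<turnstile> A \<^bold>: U; \<Gamma> \<turnstile> A \<^bold>= A' \<^bold>: U; A # \<Gamma> \<turnstile> B \<^bold>= B' \<^bold>: U\<rbrakk> \<Longrightarrow>
    \<Gamma> \<turnstile> Pi A B \<^bold>= Pi A' B' \<^bold>: U"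
| tm_Lam: "\<lbrakk>\<Gamma> \<turnstile> A ty; A # \<Gamma> \<turnstile> b \<^bold>: B\<rbrakk> \<Longrightarrow> \<Gamma> \<turnstile> Lam A b \<^bold>: Pi A B"
| eqtm_Lam: "\<lbrakk>\<Gamma> \<turnstile> A ty; \<Gamma> \<turnstile> A \<^bold>= A' ty; A # \<Gamma> \<turnstile> b \<^bold>= b' \<^bold>: B\<rbrakk> \<Longrightarrow>
    \<Gamma> \<turnstile> Lam A b \<^bold>= Lam A' b' \<^bold>: Pi A B"
| tm_App: "\<lbrakk>\<Gamma> \<turnstile> f \<^bold>: Pi A B; \<Gamma> \<turnstile> a \<^bold>: A\<rbrakk> \<Longrightarrow> \<Gamma> \<turnstile> f \<^bold>\<cdot> a \<^bold>: inst B a"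
| eqtm_App: "\<lbrakk>\<Gamma> \<turnstile> f \<^bold>= f' \<^bold>: Pi A B; \<Gamma> \<turnstile> a \<^bold>= a' \<^bold>: A\<rbrakk> \<Longrightarrow> \<Gamma> \<turnstile> f \<^bold>\<cdot> a \<^bold>= f' \<^bold>\<cdot> a' \<^bold>: inst B a"
| Pi_beta: "\<lbrakk>\<Gamma> \<turnstile> A ty; A # \<Gamma> \<turnstile> b \<^bold>: B; \<Gamma> \<turnstile> a \<^bold>: A\<rbrakk> \<Longrightarrow> \<Gamma> \<turnstile> Lam A b \<^bold>\<cdot> a \<^bold>= inst b a \<^bold>: inst B a"
| Pi_eta: "\<Gamma> \<turnstile> f \<^bold>: Pi A B \<Longrightarrow> \<Gamma> \<turnstile> f \<^bold>= Lam A (wk f \<^bold>\<cdot> Var 0) \<^bold>: Pi A B"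

| ty_Sig: "\<lbrakk>\<Gamma> \<turnstile> A ty; A # \<Gamma> \<turnstile> B ty\<rbrakk> \<Longrightarrow> \<Gamma> \<turnstile> Sig A B ty"
| eqty_Sig: "\<lbrakk>\<Gamma> \<turnstile> A ty; \<Gamma> \<turnstile> A \<^bold>= A' ty; A # \<Gamma> \<turnstile> B \<^bold>= B' ty\<rbrakk> \<Longrightarrow> \<Gamma> \<turnstile> Sig A B \<^bold>= Sig A' B' ty"
| tm_Sig: "\<lbrakk>\<Gamma> \<turnstile> A \<^bold>: U; A # \<Gamma> \<turnstile> B \<^bold>: U\<rbrakk> \<Longrightarrow> \<Gamma> \<turnstile> Sig A B \<^bold>: U"
| eqtm_Sig: "\<lbrakk>\<Gamma> \<turnstile> A \<^bold>: U; \<Gamma> \<turnstile> A \<^bold>= A' \<^bold>: U; A # \<Gamma> \<turnstile> B \<^bold>= B' \<^bold>: U\<rbrakk> \<Longrightarrow>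
    \<Gamma> \<turnstile> Sig A B \<^bold>= Sig A' B' \<^bold>: U"
| tm_Pr: "\<lbrakk>A # \<Gamma> \<turnstile> B ty; \<Gamma> \<turnstile> a \<^bold>: A; \<Gamma> \<turnstile> b \<^bold>: inst B a\<rbrakk> \<Longrightarrow> \<Gamma> \<turnstile> Pr a b \<^bold>: Sig A B"
| eqtm_Pr: "\<lbrakk>A # \<Gamma> \<turnstile> B ty; \<Gamma> \<turnstile> a \<^bold>= a' \<^bold>: A; \<Gamma> \<turnstile> b \<^bold>= b' \<^bold>: inst B a\<rbrakk> \<Longrightarrow>
    \<Gamma> \<turnstile> Pr a b \<^bold>= Pr a' b' \<^bold>: Sig A B"
| tm_SigInd: "\<lbrakk>Sig A B # \<Gamma> \<turnstile> C ty;
     B # A # \<Gamma> \<turnstile> g \<^bold>: sub (Pr (Var 1) (Var 0) ## (\<lambda>n. Var (n + 2))) C;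
     \<Gamma> \<turnstile> p \<^bold>: Sig A B\<rbrakk> \<Longrightarrow> \<Gamma> \<turnstile> SigInd C g p \<^bold>: inst C p"
| eqtm_SigInd: "\<lbrakk>Sig A B # \<Gamma> \<turnstile> C \<^bold>= C' ty;
     B # A # \<Gamma> \<turnstile> g \<^bold>= g' \<^bold>: sub (Pr (Var 1) (Var 0) ## (\<lambda>n. Var (n + 2))) C;
     \<Gamma> \<turnstile> p \<^bold>= p' \<^bold>: Sig A B\<rbrakk> \<Longrightarrow> \<Gamma> \<turnstile> SigInd C g p \<^bold>= SigInd C' g' p' \<^bold>: inst C p"
| Sig_beta: "\<lbrakk>Sig A B # \<Gamma> \<turnstile> C ty;
     B # A # \<Gamma> \<turnstile> g \<^bold>: sub (Pr (Var 1) (Var 0) ## (\<lambda>n. Var (n + 2))) C;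
     \<Gamma> \<turnstile> a \<^bold>: A; \<Gamma> \<turnstile> b \<^bold>: inst B a\<rbrakk> \<Longrightarrow>
    \<Gamma> \<turnstile> SigInd C g (Pr a b) \<^bold>= sub (b ## a ## Var) g \<^bold>: inst C (Pr a b)"

| ty_Eq: "\<lbrakk>\<Gamma> \<turnstile> A ty; \<Gamma> \<turnstile> a \<^bold>: A; \<Gamma> \<turnstile> b \<^bold>: A\<rbrakk> \<Longrightarrow> \<Gamma> \<turnstile> Eq A a b ty"
| eqty_Eq: "\<lbrakk>\<Gamma> \<turnstile> A \<^bold>= A' ty; \<Gamma> \<turnstile> a \<^bold>= a' \<^bold>: A; \<Gamma> \<turnstile> b \<^bold>= b' \<^bold>: A\<rbrakk> \<Longrightarrow>
    \<Gamma> \<turnstile> Eq A a b \<^bold>= Eq A' a' b' ty"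
| tm_Eq: "\<lbrakk>\<Gamma> \<turnstile> A \<^bold>: U; \<Gamma> \<turnstile> a \<^bold>: A; \<Gamma> \<turnstile> b \<^bold>: A\<rbrakk> \<Longrightarrow> \<Gamma> \<turnstile> Eq A a b \<^bold>: U"
| eqtm_Eq: "\<lbrakk>\<Gamma> \<turnstile> A \<^bold>= A' \<^bold>: U; \<Gamma> \<turnstile> a \<^bold>= a' \<^bold>: A; \<Gamma> \<turnstile> b \<^bold>= b' \<^bold>: A\<rbrakk> \<Longrightarrow>
    \<Gamma> \<turnstile> Eq A a b \<^bold>= Eq A' a' b' \<^bold>: U"
| tm_Refl: "\<Gamma> \<turnstile> a \<^bold>: A \<Longrightarrow> \<Gamma> \<turnstile> Refl a \<^bold>: Eq A a a"
| eqtm_Refl: "\<Gamma> \<turnstile> a \<^bold>= a' \<^bold>: A \<Longrightarrow> \<Gamma> \<turnstile> Refl a \<^bold>= Refl a' \<^bold>: Eq A a a"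
| tm_EqInd: "\<lbrakk>Eq (wk (wk A)) (Var 1) (Var 0) # wk A # A # \<Gamma> \<turnstile> C ty;
     A # \<Gamma> \<turnstile> c \<^bold>: sub (Refl (Var 0) ## Var 0 ## Var 0 ## (\<lambda>n. Var (n + 1))) C;
     \<Gamma> \<turnstile> a \<^bold>: A; \<Gamma> \<turnstile> b \<^bold>: A; \<Gamma> \<turnstile> p \<^bold>: Eq A a b\<rbrakk> \<Longrightarrow>
    \<Gamma> \<turnstile> EqInd C c a b p \<^bold>: sub (p ## b ## a ## Var) C"
| eqtm_EqInd: "\<lbrakk>Eq (wk (wk A)) (Var 1) (Var 0) # wk A # A # \<Gamma> \<turnstile> C \<^bold>= C' ty;
     A # \<Gamma> \<turnstile> c \<^bold>= c' \<^bold>: sub (Refl (Var 0) ## Var 0 ## Var 0 ## (\<lambda>n. Var (n + 1))) C;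
     \<Gamma> \<turnstile> a \<^bold>= a' \<^bold>: A; \<Gamma> \<turnstile> b \<^bold>= b' \<^bold>: A; \<Gamma> \<turnstile> p \<^bold>= p' \<^bold>: Eq A a b\<rbrakk> \<Longrightarrow>
    \<Gamma> \<turnstile> EqInd C c a b p \<^bold>= EqInd C' c' a' b' p' \<^bold>: sub (p ## b ## a ## Var) C"
| Eq_beta: "\<lbrakk>Eq (wk (wk A)) (Var 1) (Var 0) # wk A # A # \<Gamma> \<turnstile> C ty;
     A # \<Gamma> \<turnstile> c \<^bold>: sub (Refl (Var 0) ## Var 0 ## Var 0 ## (\<lambda>n. Var (n + 1))) C;
     \<Gamma> \<turnstile> a \<^bold>: A\<rbrakk> \<Longrightarrow>
    \<Gamma> \<turnstile> EqInd C c a a (Refl a) \<^bold>= inst c a \<^bold>: sub (Refl a ## a ## a ## Var) C"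

| tm_Empty: "\<Gamma> ctx \<Longrightarrow> \<Gamma> \<turnstile> Empty \<^bold>: U"
| tm_EmptyInd: "\<lbrakk>Empty # \<Gamma> \<turnstile> C ty; \<Gamma> \<turnstile> t \<^bold>: Empty\<rbrakk> \<Longrightarrow> \<Gamma> \<turnstile> EmptyInd C t \<^bold>: inst C t"
| eqtm_EmptyInd: "\<lbrakk>Empty # \<Gamma> \<turnstile> C \<^bold>= C' ty; \<Gamma> \<turnstile> t \<^bold>= t' \<^bold>: Empty\<rbrakk> \<Longrightarrow>
    \<Gamma> \<turnstile> EmptyInd C t \<^bold>= EmptyInd C' t' \<^bold>: inst C t"

| tm_One: "\<Gamma> ctx \<Longrightarrow> \<Gamma> \<turnstile> One \<^bold>: U"
| tm_Star: "\<Gamma> ctx \<Longrightarrow> \<Gamma> \<turnstile> Star \<^bold>: One"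
| tm_OneInd: "\<lbrakk>One # \<Gamma> \<turnstile> C ty; \<Gamma> \<turnstile> c \<^bold>: inst C Star; \<Gamma> \<turnstile> t \<^bold>: One\<rbrakk> \<Longrightarrow>
    \<Gamma> \<turnstile> OneInd C c t \<^bold>: inst C t"
| eqtm_OneInd: "\<lbrakk>One # \<Gamma> \<turnstile> C \<^bold>= C' ty; \<Gamma> \<turnstile> c \<^bold>= c' \<^bold>: inst C Star; \<Gamma> \<turnstile> t \<^bold>= t' \<^bold>: One\<rbrakk> \<Longrightarrow>
    \<Gamma> \<turnstile> OneInd C c t \<^bold>= OneInd C' c' t' \<^bold>: inst C t"
| One_beta: "\<lbrakk>One # \<Gamma> \<turnstile> C ty; \<Gamma> \<turnstile> c \<^bold>: inst C Star\<rbrakk> \<Longrightarrow> \<Gamma> \<turnstile> OneInd C c Star \<^bold>= c \<^bold>: inst C Star"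

| ty_Plus: "\<lbrakk>\<Gamma> \<turnstile> A ty; \<Gamma> \<turnstile> B ty\<rbrakk> \<Longrightarrow> \<Gamma> \<turnstile> Plus A B ty"
| eqty_Plus: "\<lbrakk>\<Gamma> \<turnstile> A \<^bold>= A' ty; \<Gamma> \<turnstile> B \<^bold>= B' ty\<rbrakk> \<Longrightarrow> \<Gamma> \<turnstile> Plus A B \<^bold>= Plus A' B' ty"
| tm_Plus: "\<lbrakk>\<Gamma> \<turnstile> A \<^bold>: U; \<Gamma> \<turnstile> B \<^bold>: U\<rbrakk> \<Longrightarrow> \<Gamma> \<turnstile> Plus A B \<^bold>: U"
| eqtm_Plus: "\<lbrakk>\<Gamma> \<turnstile> A \<^bold>= A' \<^bold>: U; \<Gamma> \<turnstile> B \<^bold>= B' \<^bold>: U\<rbrakk> \<Longrightarrow> \<Gamma> \<turnstile> Plus A B \<^bold>= Plus A' B' \<^bold>: U"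
| tm_InL: "\<lbrakk>\<Gamma> \<turnstile> B ty; \<Gamma> \<turnstile> a \<^bold>: A\<rbrakk> \<Longrightarrow> \<Gamma> \<turnstile> InL a \<^bold>: Plus A B"
| eqtm_InL: "\<lbrakk>\<Gamma> \<turnstile> B ty; \<Gamma> \<turnstile> a \<^bold>= a' \<^bold>: A\<rbrakk> \<Longrightarrow> \<Gamma> \<turnstile> InL a \<^bold>= InL a' \<^bold>: Plus A B"
| tm_InR: "\<lbrakk>\<Gamma> \<turnstile> A ty; \<Gamma> \<turnstile> b \<^bold>: B\<rbrakk> \<Longrightarrow> \<Gamma> \<turnstile> InR b \<^bold>: Plus A B"
| eqtm_InR: "\<lbrakk>\<Gamma> \<turnstile> A ty; \<Gamma> \<turnstile> b \<^bold>= b' \<^bold>: B\<rbrakk> \<Longrightarrow> \<Gamma> \<turnstile> InR b \<^bold>= InR b' \<^bold>: Plus A B"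
| tm_PlusInd: "\<lbrakk>Plus A B # \<Gamma> \<turnstile> C ty;
     A # \<Gamma> \<turnstile> c \<^bold>: sub (InL (Var 0) ## (\<lambda>n. Var (n + 1))) C;
     B # \<Gamma> \<turnstile> d \<^bold>: sub (InR (Var 0) ## (\<lambda>n. Var (n + 1))) C;
     \<Gamma> \<turnstile> t \<^bold>: Plus A B\<rbrakk> \<Longrightarrow> \<Gamma> \<turnstile> PlusInd C c d t \<^bold>: inst C t"
| eqtm_PlusInd: "\<lbrakk>Plus A B # \<Gamma> \<turnstile> C \<^bold>= C' ty;
     A # \<Gamma> \<turnstile> c \<^bold>= c' \<^bold>: sub (InL (Var 0) ## (\<lambda>n. Var (n + 1))) C;
     B # \<Gamma> \<turnstile> d \<^bold>= d' \<^bold>: sub (InR (Var 0) ## (\<lambda>n. Var (n + 1))) C;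
     \<Gamma> \<turnstile> t \<^bold>= t' \<^bold>: Plus A B\<rbrakk> \<Longrightarrow> \<Gamma> \<turnstile> PlusInd C c d t \<^bold>= PlusInd C' c' d' t' \<^bold>: inst C t"
| Plus_beta_L: "\<lbrakk>Plus A B # \<Gamma> \<turnstile> C ty;
     A # \<Gamma> \<turnstile> c \<^bold>: sub (InL (Var 0) ## (\<lambda>n. Var (n + 1))) C;
     B # \<Gamma> \<turnstile> d \<^bold>: sub (InR (Var 0) ## (\<lambda>n. Var (n + 1))) C;
     \<Gamma> \<turnstile> a \<^bold>: A\<rbrakk> \<Longrightarrow> \<Gamma> \<turnstile> PlusInd C c d (InL a) \<^bold>= inst c a \<^bold>: inst C (InL a)"
| Plus_beta_R: "\<lbrakk>Plus A B # \<Gamma> \<turnstile> C ty;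
     A # \<Gamma> \<turnstile> c \<^bold>: sub (InL (Var 0) ## (\<lambda>n. Var (n + 1))) C;
     B # \<Gamma> \<turnstile> d \<^bold>: sub (InR (Var 0) ## (\<lambda>n. Var (n + 1))) C;
     \<Gamma> \<turnstile> b \<^bold>: B\<rbrakk> \<Longrightarrow> \<Gamma> \<turnstile> PlusInd C c d (InR b) \<^bold>= inst d b \<^bold>: inst C (InR b)"

| tm_NN: "\<Gamma> ctx \<Longrightarrow> \<Gamma> \<turnstile> NN \<^bold>: U"
| tm_Zero: "\<Gamma> ctx \<Longrightarrow> \<Gamma> \<turnstile> Zero \<^bold>: NN"
| tm_Succ: "\<Gamma> \<turnstile> n \<^bold>: NN \<Longrightarrow> \<Gamma> \<turnstile> Succ n \<^bold>: NN"
| eqtm_Succ: "\<Gamma> \<turnstile> n \<^bold>= n' \<^bold>: NN \<Longrightarrow> \<Gamma> \<turnstile> Succ n \<^bold>= Succ n' \<^bold>: NN"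
| tm_NNInd: "\<lbrakk>NN # \<Gamma> \<turnstile> C ty; \<Gamma> \<turnstile> c \<^bold>: inst C Zero;
     C # NN # \<Gamma> \<turnstile> d \<^bold>: sub (Succ (Var 1) ## (\<lambda>n. Var (n + 2))) C;
     \<Gamma> \<turnstile> n \<^bold>: NN\<rbrakk> \<Longrightarrow> \<Gamma> \<turnstile> NNInd C c d n \<^bold>: inst C n"
| eqtm_NNInd: "\<lbrakk>NN # \<Gamma> \<turnstile> C ty; NN # \<Gamma> \<turnstile> C \<^bold>= C' ty; \<Gamma> \<turnstile> c \<^bold>= c' \<^bold>: inst C Zero;
     C # NN # \<Gamma> \<turnstile> d \<^bold>= d' \<^bold>: sub (Succ (Var 1) ## (\<lambda>n. Var (n + 2))) C;
     \<Gamma> \<turnstile> n \<^bold>= n' \<^bold>: NN\<rbrakk> \<Longrightarrow> \<Gamma> \<turnstile> NNInd C c d n \<^bold>= NNInd C' c' d' n' \<^bold>: inst C n"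
| NN_beta_Zero: "\<lbrakk>NN # \<Gamma> \<turnstile> C ty; \<Gamma> \<turnstile> c \<^bold>: inst C Zero;
     C # NN # \<Gamma> \<turnstile> d \<^bold>: sub (Succ (Var 1) ## (\<lambda>n. Var (n + 2))) C\<rbrakk> \<Longrightarrow>
    \<Gamma> \<turnstile> NNInd C c d Zero \<^bold>= c \<^bold>: inst C Zero"
| NN_beta_Succ: "\<lbrakk>NN # \<Gamma> \<turnstile> C ty; \<Gamma> \<turnstile> c \<^bold>: inst C Zero;
     C # NN # \<Gamma> \<turnstile> d \<^bold>: sub (Succ (Var 1) ## (\<lambda>n. Var (n + 2))) C;
     \<Gamma> \<turnstile> n \<^bold>: NN\<rbrakk> \<Longrightarrow>
    \<Gamma> \<turnstile> NNInd C c d (Succ n) \<^bold>= sub (NNInd C c d n ## n ## Var) d \<^bold>: inst C (Succ n)"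

| ty_Trunc: "\<Gamma> \<turnstile> A ty \<Longrightarrow> \<Gamma> \<turnstile> Trunc A ty"
| eqty_Trunc: "\<Gamma> \<turnstile> A \<^bold>= A' ty \<Longrightarrow> \<Gamma> \<turnstile> Trunc A \<^bold>= Trunc A' ty"
| tm_Trunc: "\<Gamma> \<turnstile> A \<^bold>: U \<Longrightarrow> \<Gamma> \<turnstile> Trunc A \<^bold>: U"
| eqtm_Trunc: "\<Gamma> \<turnstile> A \<^bold>= A' \<^bold>: U \<Longrightarrow> \<Gamma> \<turnstile> Trunc A \<^bold>= Trunc A' \<^bold>: U"
| tm_Tr: "\<Gamma> \<turnstile> a \<^bold>: A \<Longrightarrow> \<Gamma> \<turnstile> Tr a \<^bold>: Trunc A"
| eqtm_Tr: "\<Gamma> \<turnstile> a \<^bold>= a' \<^bold>: A \<Longrightarrow> \<Gamma> \<turnstile> Tr a \<^bold>= Tr a' \<^bold>: Trunc A"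
| tm_TrEq: "\<lbrakk>\<Gamma> \<turnstile> x \<^bold>: Trunc A; \<Gamma> \<turnstile> y \<^bold>: Trunc A\<rbrakk> \<Longrightarrow> \<Gamma> \<turnstile> TrEq x y \<^bold>: Eq (Trunc A) x y"
| eqtm_TrEq: "\<lbrakk>\<Gamma> \<turnstile> x \<^bold>= x' \<^bold>: Trunc A; \<Gamma> \<turnstile> y \<^bold>= y' \<^bold>: Trunc A\<rbrakk> \<Longrightarrow>
    \<Gamma> \<turnstile> TrEq x y \<^bold>= TrEq x' y' \<^bold>: Eq (Trunc A) x y"
| tm_TrRec: "\<lbrakk>\<Gamma> \<turnstile> B ty; \<Gamma> \<turnstile> p \<^bold>: is_prop B; \<Gamma> \<turnstile> f \<^bold>: A \<^bold>\<rightarrow> B; \<Gamma> \<turnstile> t \<^bold>: Trunc A\<rbrakk> \<Longrightarrow>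
    \<Gamma> \<turnstile> TrRec B p f t \<^bold>: B"
| eqtm_TrRec: "\<lbrakk>\<Gamma> \<turnstile> B \<^bold>= B' ty; \<Gamma> \<turnstile> p \<^bold>= p' \<^bold>: is_prop B; \<Gamma> \<turnstile> f \<^bold>= f' \<^bold>: A \<^bold>\<rightarrow> B;
     \<Gamma> \<turnstile> t \<^bold>= t' \<^bold>: Trunc A\<rbrakk> \<Longrightarrow> \<Gamma> \<turnstile> TrRec B p f t \<^bold>= TrRec B' p' f' t' \<^bold>: B"

| tm_FunExt: "\<lbrakk>\<Gamma> \<turnstile> f \<^bold>: Pi A B; \<Gamma> \<turnstile> g \<^bold>: Pi A B;
     \<Gamma> \<turnstile> h \<^bold>: Pi A (Eq B (wk f \<^bold>\<cdot> Var 0) (wk g \<^bold>\<cdot> Var 0))\<rbrakk> \<Longrightarrow>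
    \<Gamma> \<turnstile> FunExt f g h \<^bold>: Eq (Pi A B) f g"
| eqtm_FunExt: "\<lbrakk>\<Gamma> \<turnstile> f \<^bold>= f' \<^bold>: Pi A B; \<Gamma> \<turnstile> g \<^bold>= g' \<^bold>: Pi A B;
     \<Gamma> \<turnstile> h \<^bold>= h' \<^bold>: Pi A (Eq B (wk f \<^bold>\<cdot> Var 0) (wk g \<^bold>\<cdot> Var 0))\<rbrakk> \<Longrightarrow>
    \<Gamma> \<turnstile> FunExt f g h \<^bold>= FunExt f' g' h' \<^bold>: Eq (Pi A B) f g"

| tm_PropExt: "\<lbrakk>\<Gamma> \<turnstile> P \<^bold>: U; \<Gamma> \<turnstile> Q \<^bold>: U; \<Gamma> \<turnstile> p \<^bold>: is_prop P; \<Gamma> \<turnstile> q \<^bold>: is_prop Q;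
     \<Gamma> \<turnstile> f \<^bold>: P \<^bold>\<rightarrow> Q; \<Gamma> \<turnstile> g \<^bold>: Q \<^bold>\<rightarrow> P\<rbrakk> \<Longrightarrow> \<Gamma> \<turnstile> PropExt P Q p q f g \<^bold>: Eq U P Q"
| eqtm_PropExt: "\<lbrakk>\<Gamma> \<turnstile> P \<^bold>= P' \<^bold>: U; \<Gamma> \<turnstile> Q \<^bold>= Q' \<^bold>: U; \<Gamma> \<turnstile> p \<^bold>= p' \<^bold>: is_prop P; \<Gamma> \<turnstile> q \<^bold>= q' \<^bold>: is_prop Q;
     \<Gamma> \<turnstile> f \<^bold>= f' \<^bold>: P \<^bold>\<rightarrow> Q; \<Gamma> \<turnstile> g \<^bold>= g' \<^bold>: Q \<^bold>\<rightarrow> P\<rbrakk> \<Longrightarrow>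
    \<Gamma> \<turnstile> PropExt P Q p q f g \<^bold>= PropExt P' Q' p' q' f' g' \<^bold>: Eq U P Q"

definition iff_ty :: "tm \<Rightarrow> tm \<Rightarrow> tm"  (infix \<open>\<^bold>\<leftrightarrow>\<close> 55) where
  "A \<^bold>\<leftrightarrow> B = (A \<^bold>\<rightarrow> B) \<^bold>\<times> (B \<^bold>\<rightarrow> A)"

text \<open>
  The types below depend on a term \<open>D : U \<^bold>\<rightarrow> U\<close>.  Under two quantifiers over \<open>U\<close>, the outer
  variable (\<open>P\<close>, resp. \<open>X\<close>) is \<open>Var 1\<close>, the inner one (\<open>Q\<close>, resp. \<open>Y\<close>) is \<open>Var 0\<close>, and \<open>D\<close> is
  weakened twice.
\<close>

definition prop_valued :: "tm \<Rightarrow> tm" where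
  "prop_valued D = Pi U (wk D \<^bold>\<cdot> Var 0 \<^bold>\<rightarrow> is_prop (Var 0))"

definition cond_conj :: "tm \<Rightarrow> tm" where
  "cond_conj D = (let D2 = wk (wk D) in
     Pi U (Pi U (D2 \<^bold>\<cdot> Var 1 \<^bold>\<rightarrow> (Var 1 \<^bold>\<rightarrow> D2 \<^bold>\<cdot> Var 0) \<^bold>\<rightarrow> D2 \<^bold>\<cdot> (Var 1 \<^bold>\<times> Var 0))))"

definition trunc_fam :: "tm \<Rightarrow> tm" where
  "trunc_fam D = Lam U (Trunc (wk D \<^bold>\<cdot> Var 0))"

definition choice_cond :: "tm \<Rightarrow> tm" where
  "choice_cond D = (let D2 = wk (wk D) in
     Pi U (Pi U (D2 \<^bold>\<cdot> Var 1 \<^bold>\<rightarrow> (Var 1 \<^bold>\<rightarrow> Trunc (D2 \<^bold>\<cdot> Var 0))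
       \<^bold>\<rightarrow> Trunc (Var 1 \<^bold>\<rightarrow> D2 \<^bold>\<cdot> Var 0))))"

text \<open>The dominance axiom for \<open>d\<close> is conditional conjunction for \<open>d\<close>.\<close>

definition dominance_axiom :: "tm \<Rightarrow> tm" where
  "dominance_axiom d = cond_conj d"

end

theory Submission
  imports Defs
begin

text \<open>
  (1) implies (2): untruncating \<open>d P\<close> gives an element of \<open>D P\<close>, so (1) turns \<open>P \<rightarrow> \<parallel>D Q\<parallel>\<close> into
  \<open>\<parallel>P \<rightarrow> D Q\<parallel>\<close>; untruncating again, conditional conjunction applies.

  (2) implies (1): from \<open>D X\<close> and \<open>X \<rightarrow> \<parallel>D Y\<parallel>\<close> the dominance axiom gives \<open>\<parallel>D (X \<times> Y)\<parallel>\<close>, so it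
  suffices to map \<open>D (X \<times> Y)\<close> to \<open>X \<rightarrow> D Y\<close>.  Given \<open>x : X\<close>, the type \<open>Y\<close> is a proposition because
  \<open>X \<times> Y\<close> is one and \<open>(x, y) = (x, y')\<close> projects to \<open>y = y'\<close>; hence \<open>X \<times> Y = Y\<close> by proposition
  extensionality, and one transports along this identity.

  The derivations never invoke a general weakening theorem: every hypothesis that has to survive the
  extension of a context is taken to be a variable, for which weakening is immediate.
\<close>

section \<open>Renaming and substitution\<close>

lemma upr_comp: "upr r (upr q n) = upr (\<lambda>n. r (q n)) n"
  by (cases n) auto

lemma ups_upr: "ups s (upr r n) = ups (\<lambda>n. s (r n)) n"
  by (cases n) auto

lemma ups_Var: "ups (\<lambda>n. Var (r n)) = (\<lambda>n. Var (upr r n))"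
proof
  show "ups (\<lambda>n. Var (r n)) n = Var (upr r n)" for n by (cases n) auto
qed

text \<open>As simp rules, this law and the following ones make weakenings cancel against
  instantiations: a schematic term under a quantifier occurs only weakened, so instantiating the
  quantifier returns it as it was.\<close>

lemma ren_ren [simp]: "ren r (ren q t) = ren (\<lambda>n. r (q n)) t"
  by (induction t arbitrary: r q) (auto simp: upr_comp)

lemma sub_ren [simp]: "sub s (ren r t) = sub (\<lambda>n. s (r n)) t"
  by (induction t arbitrary: r s) (auto simp: ups_upr)

lemma ren_ups: "ren (upr r) (ups s n) = ups (\<lambda>n. ren r (s n)) n"
  by (cases n) auto

lemma ren_sub [simp]: "ren r (sub s t) = sub (\<lambda>n. ren r (s n)) t"
  by (induction t arbitrary: r s) (auto simp: ren_ups)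

lemma sub_Var_ren [simp]: "sub (\<lambda>n. Var (r n)) t = ren r t"
  \<comment> \<open>\<open>[simplified]\<close> pushes \<open>wk\<close> into \<open>Var\<close>,
    which is the form the lifted substitution has once the simplifier has worked on it.\<close>
  by (induction t arbitrary: r) (simp_all add: ups_Var[simplified])

lemma ren_id [simp]: "ren (\<lambda>n. n) t = t"
proof -
  have *: "upr (\<lambda>n. n) = (\<lambda>n. n)"
  proof
    show "upr (\<lambda>n. n) n = n" for n by (cases n) auto
  qed
  show ?thesis by (induction t) (auto simp: *)
qed

lemma sub_Var [simp]: "sub Var t = t"
  using sub_Var_ren[of "\<lambda>n. n"] by simp

text \<open>The defined type formers weaken their parts internally; with these rules the simplifier
  computes with them while they stay folded.\<close>

lemma ren_arr [simp]: "ren r (A \<^bold>\<rightarrow> B) = ren r A \<^bold>\<rightarrow> ren r B"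
  and sub_arr [simp]: "sub s (A \<^bold>\<rightarrow> B) = sub s A \<^bold>\<rightarrow> sub s B"
  and ren_times [simp]: "ren r (A \<^bold>\<times> B) = ren r A \<^bold>\<times> ren r B"
  and sub_times [simp]: "sub s (A \<^bold>\<times> B) = sub s A \<^bold>\<times> sub s B"
  and ren_is_prop [simp]: "ren r (is_prop A) = is_prop (ren r A)"
  and sub_is_prop [simp]: "sub s (is_prop A) = is_prop (sub s A)"
  and ren_trunc_fam [simp]: "ren r (trunc_fam D) = trunc_fam (ren r D)"
  by (simp_all add: arr_def times_def is_prop_def trunc_fam_def)

lemma ren_prop_valued [simp]: "ren r (prop_valued D) = prop_valued (ren r D)"
  and ren_cond_conj [simp]: "ren r (cond_conj D) = cond_conj (ren r D)"
  and ren_choice_cond [simp]: "ren r (choice_cond D) = choice_cond (ren r D)"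
  and ren_dominance_axiom [simp]: "ren r (dominance_axiom D) = dominance_axiom (ren r D)"
  by (simp_all add: prop_valued_def cond_conj_def choice_cond_def dominance_axiom_def Let_def)


section \<open>Derived rules\<close>

text \<open>The type of a variable as seen from the whole context. A hypothesis of the form
  \<open>var_ty \<Gamma> i = A\<close> survives a context extension by raising \<open>i\<close> and
  weakening \<open>A\<close>, which the equations below do by simplification.\<close>

definition var_ty :: "ctxt \<Rightarrow> nat \<Rightarrow> tm" where
  "var_ty \<Gamma> i = ren (\<lambda>n. n + Suc i) (\<Gamma> ! i)"

lemma var_ty_Cons [simp]:
  "var_ty (A # \<Gamma>) 0 = wk A" "var_ty (A # \<Gamma>) (Suc i) = wk (var_ty \<Gamma> i)"
  by (simp_all add: var_ty_def)

lemma Var_ty: "\<lbrakk>\<Gamma> ctx; i < length \<Gamma>; var_ty \<Gamma> i = A\<rbrakk> \<Longrightarrow> \<Gamma> \<turnstile> Var i \<^bold>: A"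
  using tm_Var[of \<Gamma> i] by (simp add: var_ty_def)

text \<open>Since the arrow is a \<open>Pi\<close> with weakened codomain, the judgement on
  \<open>wk B\<close> in the longer context is taken as a premise; for concrete types the simplifier
  supplies it.\<close>

lemma arr_ty: "\<lbrakk>\<Gamma> \<turnstile> A ty; A # \<Gamma> \<turnstile> wk B ty\<rbrakk> \<Longrightarrow> \<Gamma> \<turnstile> A \<^bold>\<rightarrow> B ty"
  and arr_U: "\<lbrakk>\<Gamma> \<turnstile> A \<^bold>: U; A # \<Gamma> \<turnstile> wk B \<^bold>: U\<rbrakk> \<Longrightarrow> \<Gamma> \<turnstile> A \<^bold>\<rightarrow> B \<^bold>: U"
  and times_U: "\<lbrakk>\<Gamma> \<turnstile> A \<^bold>: U; A # \<Gamma> \<turnstile> wk B \<^bold>: U\<rbrakk> \<Longrightarrow> \<Gamma> \<turnstile> A \<^bold>\<times> B \<^bold>: U"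
  and LamI: "\<lbrakk>\<Gamma> \<turnstile> A ty; A # \<Gamma> \<turnstile> b \<^bold>: wk B\<rbrakk> \<Longrightarrow> \<Gamma> \<turnstile> Lam A b \<^bold>: A \<^bold>\<rightarrow> B"
  by (simp_all add: arr_def times_def ty_Pi tm_Pi tm_Sig tm_Lam)

lemma LamI_ex: "\<lbrakk>\<Gamma> \<turnstile> A ty; \<exists>t. A # \<Gamma> \<turnstile> t \<^bold>: wk B\<rbrakk> \<Longrightarrow> \<exists>t. \<Gamma> \<turnstile> t \<^bold>: A \<^bold>\<rightarrow> B"
  using LamI by blast

lemma AppI: "\<lbrakk>\<Gamma> \<turnstile> f \<^bold>: A \<^bold>\<rightarrow> B; \<Gamma> \<turnstile> a \<^bold>: A\<rbrakk> \<Longrightarrow> \<Gamma> \<turnstile> f \<^bold>\<cdot> a \<^bold>: B"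
  using tm_App[of \<Gamma> f A "wk B" a] by (simp add: arr_def)

lemma PrI: "\<lbrakk>A # \<Gamma> \<turnstile> wk B ty; \<Gamma> \<turnstile> a \<^bold>: A; \<Gamma> \<turnstile> b \<^bold>: B\<rbrakk> \<Longrightarrow> \<Gamma> \<turnstile> Pr a b \<^bold>: A \<^bold>\<times> B"
  using tm_Pr[of A \<Gamma> "wk B" a b] by (simp add: times_def)

lemma PiD: "\<lbrakk>\<Gamma> \<turnstile> f \<^bold>: Pi A B; \<Gamma> \<turnstile> a \<^bold>: A; C = inst B a\<rbrakk> \<Longrightarrow> \<Gamma> \<turnstile> f \<^bold>\<cdot> a \<^bold>: C"
  using tm_App by simp

lemma is_prop_ty:
  assumes "\<Gamma> \<turnstile> A ty" "A # \<Gamma> \<turnstile> wk A ty" "wk A # A # \<Gamma> \<turnstile> wk (wk A) ty" "\<Gamma> ctx"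
  shows "\<Gamma> \<turnstile> is_prop A ty"
proof -
  have "(wk A # A # \<Gamma>) ctx" using assms by (simp add: ctx_Cons)
  then show ?thesis
    unfolding is_prop_def using assms by (auto intro!: ty_Pi ty_Eq Var_ty)
qed

lemma is_propD:
  assumes "\<Gamma> \<turnstile> h \<^bold>: is_prop A" "\<Gamma> \<turnstile> a \<^bold>: A" "\<Gamma> \<turnstile> b \<^bold>: A"
  shows "\<Gamma> \<turnstile> h \<^bold>\<cdot> a \<^bold>\<cdot> b \<^bold>: Eq A a b"
proof -
  have "\<Gamma> \<turnstile> h \<^bold>\<cdot> a \<^bold>: Pi A (Eq (wk A) (wk a) (Var 0))"
    using assms(1) unfolding is_prop_def by (rule PiD[OF _ assms(2)]) simp
  then show ?thesis by (rule PiD[OF _ assms(3)]) simp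
qed

section \<open>Cut and elimination of truncations\<close>

text \<open>Turns a compound term \<open>a\<close> into a variable by way of a redex, so that lemmas
  whose hypotheses must be variables become applicable to it.\<close>

lemma cut:
  assumes "\<Gamma> \<turnstile> A ty" "\<Gamma> \<turnstile> a \<^bold>: A" "\<exists>t. A # \<Gamma> \<turnstile> t \<^bold>: wk B"
  shows "\<exists>t. \<Gamma> \<turnstile> t \<^bold>: B"
  using AppI LamI_ex[OF assms(1,3)] assms(2) by blast

text \<open>A truncation may be opened when the goal is itself truncated, because
  \<open>TrEq\<close> makes \<open>Trunc B\<close> a proposition. The judgement on
  \<open>wk B\<close> serves the second abstraction in that proof of propositionality.\<close>

lemma Trunc_bind:
  assumes ctx: "\<Gamma> ctx" and ty: "\<Gamma> \<turnstile> A ty" "\<Gamma> \<turnstile> B ty" "Trunc B # \<Gamma> \<turnstile> wk B ty"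
    and t: "\<Gamma> \<turnstile> t \<^bold>: Trunc A" and s: "\<exists>s. A # \<Gamma> \<turnstile> s \<^bold>: Trunc (wk B)"
  shows "\<exists>t. \<Gamma> \<turnstile> t \<^bold>: Trunc B"
proof -
  have c: "(Trunc (wk B) # Trunc B # \<Gamma>) ctx" using ctx ty by (simp add: ctx_Cons ty_Trunc)
  have "\<Gamma> \<turnstile> Lam (Trunc B) (Lam (Trunc (wk B)) (TrEq (Var 1) (Var 0))) \<^bold>: is_prop (Trunc B)"
    unfolding is_prop_def using c ty
    by (auto intro!: tm_Lam ty_Trunc tm_TrEq Var_ty)
  moreover from s obtain s where "A # \<Gamma> \<turnstile> s \<^bold>: wk (Trunc B)" by auto
  then have "\<Gamma> \<turnstile> Lam A s \<^bold>: A \<^bold>\<rightarrow> Trunc B" using ty by (intro LamI)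
  ultimately show ?thesis using ty t by (blast intro: tm_TrRec ty_Trunc)
qed

section \<open>Families over the universe and the truncated family\<close>

lemma fam_App_U:
  assumes "\<Gamma> ctx" "k < length \<Gamma>" "var_ty \<Gamma> k = U \<^bold>\<rightarrow> U" "\<Gamma> \<turnstile> X \<^bold>: U"
  shows "\<Gamma> \<turnstile> Var k \<^bold>\<cdot> X \<^bold>: U"
  using assms by (auto intro: AppI Var_ty)

lemmas ty_rules = ctx_Cons ty_U ty_El Var_ty arr_ty arr_U times_U fam_App_U tm_Trunc

lemma trunc_fam_ty:
  assumes "\<Gamma> ctx" "k < length \<Gamma>" "var_ty \<Gamma> k = U \<^bold>\<rightarrow> U"
  shows "\<Gamma> \<turnstile> trunc_fam (Var k) \<^bold>: U \<^bold>\<rightarrow> U"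
  unfolding trunc_fam_def using assms by (intro LamI) (simp_all add: ty_rules)

text \<open>\<open>trunc_fam\<close> is an abstraction, so \<open>d X\<close> and the truncation of
  \<open>D X\<close> are related by beta; passages between the two are conversions along this
  equality.\<close>

lemma trunc_fam_App:
  assumes "\<Gamma> ctx" "k < length \<Gamma>" "var_ty \<Gamma> k = U \<^bold>\<rightarrow> U" "\<Gamma> \<turnstile> X \<^bold>: U"
  shows "\<Gamma> \<turnstile> trunc_fam (Var k) \<^bold>\<cdot> X \<^bold>= Trunc (Var k \<^bold>\<cdot> X) \<^bold>: U"
proof -
  have "U # \<Gamma> \<turnstile> Trunc (Var (Suc k) \<^bold>\<cdot> Var 0) \<^bold>: U" using assms by (simp add: ty_rules)
  from Pi_beta[OF _ this assms(4)] show ?thesis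
    using assms by (simp add: trunc_fam_def ty_rules)
qed

lemma trunc_fam_App_U:
  assumes "\<Gamma> ctx" "k < length \<Gamma>" "var_ty \<Gamma> k = U \<^bold>\<rightarrow> U" "\<Gamma> \<turnstile> X \<^bold>: U"
  shows "\<Gamma> \<turnstile> trunc_fam (Var k) \<^bold>\<cdot> X \<^bold>: U"
  using assms by (auto intro: AppI trunc_fam_ty)

section \<open>Introducing and using the quantified conditions\<close>

text \<open>The common shape of \<open>choice_cond\<close> and \<open>cond_conj\<close>: once the
  four binders are stripped, both types and both arguments are variables.\<close>

lemma PiPi_arr_arrI:
  assumes "\<Gamma> ctx" "U # U # \<Gamma> \<turnstile> A ty" "A # U # U # \<Gamma> \<turnstile> wk B ty"
    "\<exists>t. wk B # A # U # U # \<Gamma> \<turnstile> t \<^bold>: wk (wk C)"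
  shows "\<exists>t. \<Gamma> \<turnstile> t \<^bold>: Pi U (Pi U (A \<^bold>\<rightarrow> B \<^bold>\<rightarrow> C))"
proof -
  from assms(4) obtain t where "wk B # A # U # U # \<Gamma> \<turnstile> t \<^bold>: wk (wk C)" ..
  with assms(1-3) have "\<Gamma> \<turnstile> Lam U (Lam U (Lam A (Lam (wk B) t))) \<^bold>: Pi U (Pi U (A \<^bold>\<rightarrow> B \<^bold>\<rightarrow> C))"
    by (auto intro!: tm_Lam LamI ty_U ctx_Cons)
  then show ?thesis ..
qed

text \<open>Holds for any \<open>D\<close>, hence serves both the given family and, through
  \<open>dominance_axiom\<close>, the truncated one.\<close>

lemma cond_conjD:
  assumes "\<Gamma> \<turnstile> c \<^bold>: cond_conj D" "\<Gamma> \<turnstile> P \<^bold>: U" "\<Gamma> \<turnstile> Q \<^bold>: U" "\<Gamma> \<turnstile> a \<^bold>: D \<^bold>\<cdot> P" "\<Gamma> \<turnstile> f \<^bold>: P \<^bold>\<rightarrow> D \<^bold>\<cdot> Q"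
  shows "\<Gamma> \<turnstile> c \<^bold>\<cdot> P \<^bold>\<cdot> Q \<^bold>\<cdot> a \<^bold>\<cdot> f \<^bold>: D \<^bold>\<cdot> (P \<^bold>\<times> Q)"
proof -
  have "\<Gamma> \<turnstile> c \<^bold>\<cdot> P \<^bold>\<cdot> Q \<^bold>: D \<^bold>\<cdot> P \<^bold>\<rightarrow> (P \<^bold>\<rightarrow> D \<^bold>\<cdot> Q) \<^bold>\<rightarrow> D \<^bold>\<cdot> (P \<^bold>\<times> Q)"
    using PiD[OF assms(1)[unfolded cond_conj_def Let_def] assms(2) refl, simplified]
    by (rule PiD[OF _ assms(3)]) simp
  then show ?thesis using assms by (blast intro: AppI)
qed

lemma choice_condD:
  assumes "\<Gamma> \<turnstile> c \<^bold>: choice_cond D" "\<Gamma> \<turnstile> P \<^bold>: U" "\<Gamma> \<turnstile> Q \<^bold>: U" "\<Gamma> \<turnstile> a \<^bold>: D \<^bold>\<cdot> P"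
    "\<Gamma> \<turnstile> f \<^bold>: P \<^bold>\<rightarrow> Trunc (D \<^bold>\<cdot> Q)"
  shows "\<Gamma> \<turnstile> c \<^bold>\<cdot> P \<^bold>\<cdot> Q \<^bold>\<cdot> a \<^bold>\<cdot> f \<^bold>: Trunc (P \<^bold>\<rightarrow> D \<^bold>\<cdot> Q)"
proof -
  have "\<Gamma> \<turnstile> c \<^bold>\<cdot> P \<^bold>\<cdot> Q \<^bold>: D \<^bold>\<cdot> P \<^bold>\<rightarrow> (P \<^bold>\<rightarrow> Trunc (D \<^bold>\<cdot> Q)) \<^bold>\<rightarrow> Trunc (P \<^bold>\<rightarrow> D \<^bold>\<cdot> Q)"
    using PiD[OF assms(1)[unfolded choice_cond_def Let_def] assms(2) refl, simplified]
    by (rule PiD[OF _ assms(3)]) simp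
  then show ?thesis using assms by (blast intro: AppI)
qed

lemma prop_valuedD:
  assumes "\<Gamma> \<turnstile> h \<^bold>: prop_valued D" "\<Gamma> \<turnstile> P \<^bold>: U" "\<Gamma> \<turnstile> a \<^bold>: D \<^bold>\<cdot> P"
  shows "\<Gamma> \<turnstile> h \<^bold>\<cdot> P \<^bold>\<cdot> a \<^bold>: is_prop P"
proof -
  have "\<Gamma> \<turnstile> h \<^bold>\<cdot> P \<^bold>: D \<^bold>\<cdot> P \<^bold>\<rightarrow> is_prop P"
    using assms(1) unfolding prop_valued_def by (rule PiD[OF _ assms(2)]) simp
  then show ?thesis using assms by (blast intro: AppI)
qed

section \<open>Well-formedness of the conditions\<close>

lemma choice_cond_ty:
  assumes "\<Gamma> ctx" "k < length \<Gamma>" "var_ty \<Gamma> k = U \<^bold>\<rightarrow> U"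
  shows "\<Gamma> \<turnstile> choice_cond (Var k) ty"
  unfolding choice_cond_def Let_def
  by (intro ty_Pi) (simp_all add: assms ty_rules)

lemma cond_conj_ty:
  assumes "\<Gamma> ctx" "k < length \<Gamma>" "var_ty \<Gamma> k = U \<^bold>\<rightarrow> U"
  shows "\<Gamma> \<turnstile> cond_conj (Var k) ty"
  unfolding cond_conj_def Let_def
  by (intro ty_Pi) (simp_all add: assms ty_rules)

lemma dominance_axiom_ty:
  assumes "\<Gamma> ctx" "k < length \<Gamma>" "var_ty \<Gamma> k = U \<^bold>\<rightarrow> U"
  shows "\<Gamma> \<turnstile> dominance_axiom (trunc_fam (Var k)) ty"
  unfolding dominance_axiom_def cond_conj_def Let_def
  by (intro ty_Pi) (simp_all add: assms ty_rules trunc_fam_App_U)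

lemma prop_valued_ty:
  assumes "\<Gamma> ctx" "k < length \<Gamma>" "var_ty \<Gamma> k = U \<^bold>\<rightarrow> U"
  shows "\<Gamma> \<turnstile> prop_valued (Var k) ty"
  unfolding prop_valued_def
  by (intro ty_Pi) (simp_all add: assms ty_rules is_prop_ty)


section \<open>The two implications\<close>

text \<open>The second argument of the dominance axiom is a function into \<open>d Q\<close>, so the
  beta step has to be taken under the binder of the arrow.\<close>

lemma arr_trunc_fam_eq:
  assumes "\<Gamma> ctx" "k < length \<Gamma>" "var_ty \<Gamma> k = U \<^bold>\<rightarrow> U" "\<Gamma> \<turnstile> A \<^bold>: U" "A # \<Gamma> \<turnstile> wk X \<^bold>: U"
  shows "\<Gamma> \<turnstile> A \<^bold>\<rightarrow> trunc_fam (Var k) \<^bold>\<cdot> X \<^bold>= A \<^bold>\<rightarrow> Trunc (Var k \<^bold>\<cdot> X) ty"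
proof -
  have "A # \<Gamma> \<turnstile> trunc_fam (Var (Suc k)) \<^bold>\<cdot> wk X \<^bold>= Trunc (Var (Suc k) \<^bold>\<cdot> wk X) ty"
    using assms by (intro eqty_El trunc_fam_App) (simp_all add: ty_rules)
  then show ?thesis
    using assms(4) by (simp add: arr_def eqty_Pi eqty_refl ty_El)
qed

text \<open>The implication with all binders already turned into variables. The derivation is
  assembled from the innermost context outwards.\<close>

lemma dominance_of_choice:
  assumes ctx: "\<Gamma> ctx"
    and D: "k < length \<Gamma>" "var_ty \<Gamma> k = U \<^bold>\<rightarrow> U"
    and conj: "m < length \<Gamma>" "var_ty \<Gamma> m = cond_conj (Var k)"
    and choice: "c < length \<Gamma>" "var_ty \<Gamma> c = choice_cond (Var k)"
    and P: "i < length \<Gamma>" "var_ty \<Gamma> i = U" and Q: "j < length \<Gamma>" "var_ty \<Gamma> j = U"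
    and p: "p < length \<Gamma>" "var_ty \<Gamma> p = trunc_fam (Var k) \<^bold>\<cdot> Var i"
    and q: "q < length \<Gamma>" "var_ty \<Gamma> q = Var i \<^bold>\<rightarrow> trunc_fam (Var k) \<^bold>\<cdot> Var j"
  shows "\<exists>t. \<Gamma> \<turnstile> t \<^bold>: trunc_fam (Var k) \<^bold>\<cdot> (Var i \<^bold>\<times> Var j)"
proof -
  let ?d = "trunc_fam (Var k)" and ?T = "Var i \<^bold>\<times> Var j"
  let ?k = "Suc k" and ?i = "Suc i" and ?j = "Suc j"
  let ?\<Delta> = "Var k \<^bold>\<cdot> Var i # \<Gamma>"
  let ?F = "Var ?i \<^bold>\<rightarrow> Var ?k \<^bold>\<cdot> Var ?j"
  have \<Delta>: "?\<Delta> ctx" using ctx D P by (simp add: ty_rules)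
  have F: "?\<Delta> \<turnstile> ?F ty" using \<Delta> D P Q by (simp add: ty_rules)
  have \<Delta>': "(?F # ?\<Delta>) ctx" using \<Delta> F by (rule ctx_Cons)
  \<comment> \<open>After both truncations are opened, \<open>Var 1\<close> is the element of
    \<open>D P\<close> and \<open>Var 0\<close> the function from \<open>P\<close> to
    \<open>D Q\<close>; conditional conjunction combines them.\<close>
  have "?F # ?\<Delta> \<turnstile> Var (Suc (Suc m)) \<^bold>\<cdot> Var (Suc ?i) \<^bold>\<cdot> Var (Suc ?j) \<^bold>\<cdot> Var 1 \<^bold>\<cdot> Var 0
      \<^bold>: Var (Suc ?k) \<^bold>\<cdot> (Var (Suc ?i) \<^bold>\<times> Var (Suc ?j))"
    using \<Delta>' conj P Q by (intro cond_conjD Var_ty) simp_all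
  from tm_Tr[OF this] have s': "\<exists>s. ?F # ?\<Delta> \<turnstile> s \<^bold>: Trunc (wk (wk (Var k \<^bold>\<cdot> ?T)))"
    by auto
  have "?\<Delta> \<turnstile> Var (Suc q) \<^bold>: Var ?i \<^bold>\<rightarrow> trunc_fam (Var ?k) \<^bold>\<cdot> Var ?j"
    using \<Delta> q by (simp add: Var_ty)
  moreover have "?\<Delta> \<turnstile> Var ?i \<^bold>\<rightarrow> trunc_fam (Var ?k) \<^bold>\<cdot> Var ?j \<^bold>= Var ?i \<^bold>\<rightarrow> Trunc (Var ?k \<^bold>\<cdot> Var ?j) ty"
    using \<Delta> D P Q by (intro arr_trunc_fam_eq) (simp_all add: ty_rules)
  ultimately have "?\<Delta> \<turnstile> Var (Suc q) \<^bold>: Var ?i \<^bold>\<rightarrow> Trunc (Var ?k \<^bold>\<cdot> Var ?j)"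
    by (rule tm_conv)
  \<comment> \<open>With only the first truncation opened, \<open>Var 0\<close> is the element of
    \<open>D P\<close> that the choice condition asks for.\<close>
  then have t': "?\<Delta> \<turnstile> Var (Suc c) \<^bold>\<cdot> Var ?i \<^bold>\<cdot> Var ?j \<^bold>\<cdot> Var 0 \<^bold>\<cdot> Var (Suc q) \<^bold>: Trunc ?F"
    using \<Delta> choice P Q by (intro choice_condD) (simp_all add: Var_ty)
  have s: "\<exists>s. ?\<Delta> \<turnstile> s \<^bold>: Trunc (wk (Var k \<^bold>\<cdot> ?T))"
    using \<Delta> D P Q s' by (intro Trunc_bind[OF \<Delta> F _ _ t']) (simp_all add: ty_rules)
  have "\<Gamma> \<turnstile> Var p \<^bold>: ?d \<^bold>\<cdot> Var i"
    using ctx p by (rule Var_ty)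
  moreover have "\<Gamma> \<turnstile> ?d \<^bold>\<cdot> Var i \<^bold>= Trunc (Var k \<^bold>\<cdot> Var i) ty"
    using ctx D P by (intro eqty_El trunc_fam_App Var_ty)
  ultimately have t: "\<Gamma> \<turnstile> Var p \<^bold>: Trunc (Var k \<^bold>\<cdot> Var i)" by (rule tm_conv)
  have "\<exists>t. \<Gamma> \<turnstile> t \<^bold>: Trunc (Var k \<^bold>\<cdot> ?T)"
    using ctx D P Q s by (intro Trunc_bind[OF ctx _ _ _ t]) (simp_all add: ty_rules)
  moreover have "\<Gamma> \<turnstile> Trunc (Var k \<^bold>\<cdot> ?T) \<^bold>= ?d \<^bold>\<cdot> ?T ty"
    using ctx D P Q by (intro eqty_sym[OF eqty_El] trunc_fam_App) (simp_all add: ty_rules)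
  ultimately show ?thesis by (blast intro: tm_conv)
qed

lemma choice_imp_dominance:
  assumes ctx: "\<Gamma> ctx"
    and D: "k < length \<Gamma>" "var_ty \<Gamma> k = U \<^bold>\<rightarrow> U"
    and conj: "m < length \<Gamma>" "var_ty \<Gamma> m = cond_conj (Var k)"
    and choice: "c < length \<Gamma>" "var_ty \<Gamma> c = choice_cond (Var k)"
  shows "\<exists>t. \<Gamma> \<turnstile> t \<^bold>: dominance_axiom (trunc_fam (Var k))"
proof -
  let ?d = "trunc_fam (Var (k + 2))"
  let ?A = "?d \<^bold>\<cdot> Var 1" and ?B = "Var 1 \<^bold>\<rightarrow> ?d \<^bold>\<cdot> Var 0"
  have A: "U # U # \<Gamma> \<turnstile> ?A ty" and B: "?A # U # U # \<Gamma> \<turnstile> wk ?B ty"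
    using ctx D by (simp_all add: ty_rules trunc_fam_App_U)
  then have "(wk ?B # ?A # U # U # \<Gamma>) ctx" using ctx by (intro ctx_Cons ty_U)
  \<comment> \<open>Four entries were added: \<open>Var 3\<close> and \<open>Var 2\<close> are
    \<open>P\<close> and \<open>Q\<close>, \<open>Var 1\<close> is the element of
    \<open>d P\<close>, \<open>Var 0\<close> the function; older indices rise by 4.\<close>
  then have "\<exists>t. wk ?B # ?A # U # U # \<Gamma> \<turnstile> t \<^bold>: trunc_fam (Var (k + 4)) \<^bold>\<cdot> (Var 3 \<^bold>\<times> Var 2)"
    using D conj choice
    by (intro dominance_of_choice[where m = "m + 4" and c = "c + 4" and p = 1 and q = 0])
      (simp_all add: eval_nat_numeral)
  then show ?thesis
    unfolding dominance_axiom_def cond_conj_def Let_def using ctx A B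
    by (intro PiPi_arr_arrI) (simp_all add: eval_nat_numeral)
qed

section \<open>The second factor of a propositional product\<close>

text \<open>This \<open>SigInd\<close> is the second projection: its motive is \<open>Y\<close>
  weakened past the pair, and its branch returns the later component.\<close>

lemma times_snd:
  assumes "\<Gamma> ctx" "i < length \<Gamma>" "var_ty \<Gamma> i = U" "j < length \<Gamma>" "var_ty \<Gamma> j = U"
    and "\<Gamma> \<turnstile> p \<^bold>: Var i \<^bold>\<times> Var j"
  shows "\<Gamma> \<turnstile> SigInd (Var (Suc j)) (Var 0) p \<^bold>: Var j"
proof -
  have "Sig (Var i) (Var (Suc j)) # \<Gamma> \<turnstile> Var (Suc j) ty"
    "Var (Suc j) # Var i # \<Gamma> \<turnstile> Var 0 \<^bold>: Var (Suc (Suc j))"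
    using assms by (simp_all add: ty_rules tm_Sig)
  from tm_SigInd[OF this(1), of "Var 0" p] this assms(6) show ?thesis
    by (simp add: times_def)
qed

lemma times_snd_Pr:
  assumes "\<Gamma> ctx" "i < length \<Gamma>" "var_ty \<Gamma> i = U" "j < length \<Gamma>" "var_ty \<Gamma> j = U"
    and "\<Gamma> \<turnstile> a \<^bold>: Var i" "\<Gamma> \<turnstile> b \<^bold>: Var j"
  shows "\<Gamma> \<turnstile> SigInd (Var (Suc j)) (Var 0) (Pr a b) \<^bold>= b \<^bold>: Var j"
proof -
  have "Sig (Var i) (Var (Suc j)) # \<Gamma> \<turnstile> Var (Suc j) ty"
    "Var (Suc j) # Var i # \<Gamma> \<turnstile> Var 0 \<^bold>: Var (Suc (Suc j))"
    using assms by (simp_all add: ty_rules tm_Sig)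
  from Sig_beta[OF this(1), of "Var 0" a b] this assms(6,7) show ?thesis
    by simp
qed

lemma is_prop_of_times:
  assumes ctx: "\<Gamma> ctx"
    and X: "i < length \<Gamma>" "var_ty \<Gamma> i = U" and Y: "j < length \<Gamma>" "var_ty \<Gamma> j = U"
    and x: "x < length \<Gamma>" "var_ty \<Gamma> x = Var i"
    and h: "h < length \<Gamma>" "var_ty \<Gamma> h = is_prop (Var i \<^bold>\<times> Var j)"
  shows "\<exists>t. \<Gamma> \<turnstile> t \<^bold>: is_prop (Var j)"
proof -
  \<comment> \<open>\<open>Var 1\<close> and \<open>Var 0\<close> of this context are the two
    elements of \<open>Y\<close> to be identified.\<close>
  let ?\<Delta> = "Var (Suc j) # Var j # \<Gamma>" and ?j2 = "Suc (Suc j)"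
  let ?T = "Var (Suc (Suc i)) \<^bold>\<times> Var ?j2"
  let ?p = "Pr (Var (Suc (Suc x))) (Var 1)" and ?q = "Pr (Var (Suc (Suc x))) (Var 0)"
  let ?snd = "\<lambda>j. SigInd (Var (Suc j)) (Var 0)"
  let ?E = "Eq (wk (wk ?T)) (Var 1) (Var 0) # wk ?T # ?T # ?\<Delta>"
  \<comment> \<open>Motive for applying the second projection to a path: \<open>Var 2\<close> and
    \<open>Var 1\<close> are its endpoints, \<open>Var 0\<close> the path itself.\<close>
  let ?C = "Eq (Var (?j2 + 3)) (?snd (?j2 + 3) (Var 2)) (?snd (?j2 + 3) (Var 1))"
  note vars = ctx X Y x h
  have c: "?\<Delta> ctx" using vars by (simp add: ty_rules)
  have cT: "(?T # ?\<Delta>) ctx" "(wk ?T # ?T # ?\<Delta>) ctx" using c vars by (simp_all add: ty_rules)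
  then have cE: "?E ctx" using vars by (auto simp: ty_rules intro!: ctx_Cons ty_Eq Var_ty)
  have pq: "?\<Delta> \<turnstile> ?p \<^bold>: ?T" "?\<Delta> \<turnstile> ?q \<^bold>: ?T"
    using c vars by (auto intro!: PrI simp: ty_rules)
  have "?\<Delta> \<turnstile> Var (Suc (Suc h)) \<^bold>: is_prop ?T" using c vars by (simp add: Var_ty)
  from is_propD[OF this pq]
  have eq: "?\<Delta> \<turnstile> Var (Suc (Suc h)) \<^bold>\<cdot> ?p \<^bold>\<cdot> ?q \<^bold>: Eq ?T ?p ?q" .
  have C: "?E \<turnstile> ?C ty"
    using cE vars by (intro ty_Eq ty_El times_snd[where i = "i + 5"]) (simp_all add: Var_ty eval_nat_numeral)
  have "?T # ?\<Delta> \<turnstile> Refl (?snd (Suc ?j2) (Var 0)) \<^bold>: Eq (Var (Suc ?j2)) (?snd (Suc ?j2) (Var 0)) (?snd (Suc ?j2) (Var 0))"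
    using cT vars by (intro tm_Refl times_snd[where i = "i + 3"]) (simp_all add: Var_ty eval_nat_numeral)
  with tm_EqInd[OF C _ pq eq]
  have "\<exists>t. ?\<Delta> \<turnstile> t \<^bold>: Eq (Var ?j2) (?snd ?j2 ?p) (?snd ?j2 ?q)"
    by (auto simp: eval_nat_numeral)
  \<comment> \<open>The projections of the two explicit pairs compute, leaving the equation between
    the given elements.\<close>
  moreover have "?\<Delta> \<turnstile> Eq (Var ?j2) (?snd ?j2 ?p) (?snd ?j2 ?q) \<^bold>= Eq (Var ?j2) (Var 1) (Var 0) ty"
    using c vars by (intro eqty_Eq eqty_refl ty_El times_snd_Pr[where i = "i + 2"]) (simp_all add: Var_ty)
  ultimately obtain t where "?\<Delta> \<turnstile> t \<^bold>: Eq (Var ?j2) (Var 1) (Var 0)"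
    by (blast intro: tm_conv)
  then have "\<Gamma> \<turnstile> Lam (Var j) (Lam (Var (Suc j)) t) \<^bold>: is_prop (Var j)"
    unfolding is_prop_def using vars by (auto intro!: tm_Lam simp: ty_rules)
  then show ?thesis ..
qed

text \<open>Path induction over \<open>U\<close> with the motive "\<open>D\<close> of the first
  endpoint implies \<open>D\<close> of the second"; the reflexivity case is the identity
  function.\<close>

lemma fam_transport:
  assumes ctx: "\<Gamma> ctx" and D: "k < length \<Gamma>" "var_ty \<Gamma> k = U \<^bold>\<rightarrow> U"
    and PQ: "\<Gamma> \<turnstile> P \<^bold>: U" "\<Gamma> \<turnstile> Q \<^bold>: U" and p: "\<Gamma> \<turnstile> p \<^bold>: Eq U P Q" and e: "\<Gamma> \<turnstile> e \<^bold>: Var k \<^bold>\<cdot> P"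
  shows "\<exists>t. \<Gamma> \<turnstile> t \<^bold>: Var k \<^bold>\<cdot> Q"
proof -
  let ?E = "Eq (wk (wk U)) (Var 1) (Var 0) # wk U # U # \<Gamma>"
  let ?C = "Var (k + 3) \<^bold>\<cdot> Var 2 \<^bold>\<rightarrow> Var (k + 3) \<^bold>\<cdot> Var 1"
  have c: "?E ctx" using ctx by (simp add: ty_rules ty_Eq)
  then have C: "?E \<turnstile> ?C ty" using D by (simp add: ty_rules eval_nat_numeral)
  have "U # \<Gamma> \<turnstile> Lam (Var (Suc k) \<^bold>\<cdot> Var 0) (Var 0) \<^bold>: Var (Suc k) \<^bold>\<cdot> Var 0 \<^bold>\<rightarrow> Var (Suc k) \<^bold>\<cdot> Var 0"
    using ctx D by (intro LamI) (simp_all add: ty_rules)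
  with tm_EqInd[OF C _ PQ p] obtain t where "\<Gamma> \<turnstile> t \<^bold>: Var k \<^bold>\<cdot> P \<^bold>\<rightarrow> Var k \<^bold>\<cdot> Q"
    by (auto simp: eval_nat_numeral)
  then show ?thesis using e by (blast intro: AppI)
qed

text \<open>Second projection and pairing with \<open>x\<close> make \<open>X \<times> Y\<close> and
  \<open>Y\<close> logically equivalent propositions. The index \<open>h\<close> has to denote a
  variable since it is carried under binders, whereas \<open>e\<close> is used in
  \<open>\<Gamma>\<close> alone and may be any term.\<close>

lemma fam_of_times:
  assumes ctx: "\<Gamma> ctx"
    and D: "k < length \<Gamma>" "var_ty \<Gamma> k = U \<^bold>\<rightarrow> U"
    and X: "i < length \<Gamma>" "var_ty \<Gamma> i = U" and Y: "j < length \<Gamma>" "var_ty \<Gamma> j = U"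
    and x: "x < length \<Gamma>" "var_ty \<Gamma> x = Var i"
    and h: "h < length \<Gamma>" "var_ty \<Gamma> h = is_prop (Var i \<^bold>\<times> Var j)"
    and e: "\<Gamma> \<turnstile> e \<^bold>: Var k \<^bold>\<cdot> (Var i \<^bold>\<times> Var j)"
  shows "\<exists>t. \<Gamma> \<turnstile> t \<^bold>: Var k \<^bold>\<cdot> Var j"
proof -
  let ?T = "Var i \<^bold>\<times> Var j"
  obtain q where q: "\<Gamma> \<turnstile> q \<^bold>: is_prop (Var j)"
    using is_prop_of_times[OF ctx X Y x h] ..
  have T: "\<Gamma> \<turnstile> ?T \<^bold>: U" using ctx X Y by (simp add: ty_rules)
  have J: "\<Gamma> \<turnstile> Var j \<^bold>: U" using ctx Y by (simp add: ty_rules)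
  have H: "\<Gamma> \<turnstile> Var h \<^bold>: is_prop ?T" using ctx h by (simp add: ty_rules)
  have "(?T # \<Gamma>) ctx" using ctx T by (simp add: ty_rules)
  then have f: "\<Gamma> \<turnstile> Lam ?T (SigInd (Var (Suc (Suc j))) (Var 0) (Var 0)) \<^bold>: ?T \<^bold>\<rightarrow> Var j"
    using T X Y by (intro LamI ty_El) (simp_all add: times_snd[where i = "Suc i"] Var_ty)
  have "(Var j # \<Gamma>) ctx" using ctx J by (simp add: ty_rules)
  then have g: "\<Gamma> \<turnstile> Lam (Var j) (Pr (Var (Suc x)) (Var 0)) \<^bold>: Var j \<^bold>\<rightarrow> ?T"
    using J X Y x by (intro LamI ty_El) (simp_all add: PrI ty_rules)
  show ?thesis
    by (rule fam_transport[OF ctx D T J tm_PropExt[OF T J H q f g] e])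
qed

text \<open>Propositionality of the product comes from \<open>prop_valued\<close> as a compound
  term; \<open>cut\<close> makes it \<open>Var 0\<close> of a longer context, as
  \<open>fam_of_times\<close> requires.\<close>

lemma fam_of_times_prop_valued:
  assumes ctx: "\<Gamma> ctx"
    and D: "k < length \<Gamma>" "var_ty \<Gamma> k = U \<^bold>\<rightarrow> U"
    and pv: "m < length \<Gamma>" "var_ty \<Gamma> m = prop_valued (Var k)"
    and X: "i < length \<Gamma>" "var_ty \<Gamma> i = U" and Y: "j < length \<Gamma>" "var_ty \<Gamma> j = U"
    and x: "x < length \<Gamma>" "var_ty \<Gamma> x = Var i"
    and e: "e < length \<Gamma>" "var_ty \<Gamma> e = Var k \<^bold>\<cdot> (Var i \<^bold>\<times> Var j)"
  shows "\<exists>t. \<Gamma> \<turnstile> t \<^bold>: Var k \<^bold>\<cdot> Var j"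
proof -
  let ?T = "Var i \<^bold>\<times> Var j"
  have T: "\<Gamma> \<turnstile> is_prop ?T ty"
    using ctx X Y by (intro is_prop_ty) (simp_all add: ty_rules)
  have "\<Gamma> \<turnstile> Var m \<^bold>\<cdot> ?T \<^bold>\<cdot> Var e \<^bold>: is_prop ?T"
    using ctx pv X Y e by (intro prop_valuedD[where D = "Var k"]) (simp_all add: ty_rules)
  moreover have c: "(is_prop ?T # \<Gamma>) ctx" using ctx T by (rule ctx_Cons)
  have "is_prop ?T # \<Gamma> \<turnstile> Var (Suc e) \<^bold>: Var (Suc k) \<^bold>\<cdot> (Var (Suc i) \<^bold>\<times> Var (Suc j))"
    using c e by (simp add: Var_ty)
  with c D X Y x have "\<exists>t. is_prop ?T # \<Gamma> \<turnstile> t \<^bold>: Var (Suc k) \<^bold>\<cdot> Var (Suc j)"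
    by (intro fam_of_times[where i = "Suc i" and x = "Suc x" and h = 0]) simp_all
  ultimately show ?thesis using T by (intro cut) simp_all
qed

section \<open>From the dominance axiom to the choice condition\<close>

lemma choice_of_dominance:
  assumes ctx: "\<Gamma> ctx"
    and D: "k < length \<Gamma>" "var_ty \<Gamma> k = U \<^bold>\<rightarrow> U"
    and pv: "m < length \<Gamma>" "var_ty \<Gamma> m = prop_valued (Var k)"
    and dom: "c < length \<Gamma>" "var_ty \<Gamma> c = dominance_axiom (trunc_fam (Var k))"
    and X: "i < length \<Gamma>" "var_ty \<Gamma> i = U" and Y: "j < length \<Gamma>" "var_ty \<Gamma> j = U"
    and a: "a < length \<Gamma>" "var_ty \<Gamma> a = Var k \<^bold>\<cdot> Var i"
    and q: "q < length \<Gamma>" "var_ty \<Gamma> q = Var i \<^bold>\<rightarrow> Trunc (Var k \<^bold>\<cdot> Var j)"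
  shows "\<exists>t. \<Gamma> \<turnstile> t \<^bold>: Trunc (Var i \<^bold>\<rightarrow> Var k \<^bold>\<cdot> Var j)"
proof -
  let ?d = "trunc_fam (Var k)" and ?T = "Var i \<^bold>\<times> Var j"
  let ?\<Delta> = "Var k \<^bold>\<cdot> ?T # \<Gamma>"
  let ?\<Delta>' = "Var (Suc i) # ?\<Delta>"
  have T: "\<Gamma> \<turnstile> ?T \<^bold>: U" using ctx X Y by (simp add: ty_rules)
  \<comment> \<open>The dominance axiom expects an element of \<open>d X\<close>, so the given
    element of \<open>D X\<close> is truncated first.\<close>
  have "\<Gamma> \<turnstile> Tr (Var a) \<^bold>: Trunc (Var k \<^bold>\<cdot> Var i)"
    using ctx a by (intro tm_Tr Var_ty)
  moreover have "\<Gamma> \<turnstile> Trunc (Var k \<^bold>\<cdot> Var i) \<^bold>= ?d \<^bold>\<cdot> Var i ty"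
    using ctx D X by (intro eqty_sym[OF eqty_El] trunc_fam_App Var_ty)
  ultimately have a': "\<Gamma> \<turnstile> Tr (Var a) \<^bold>: ?d \<^bold>\<cdot> Var i" by (rule tm_conv)
  have "\<Gamma> \<turnstile> Var q \<^bold>: Var i \<^bold>\<rightarrow> Trunc (Var k \<^bold>\<cdot> Var j)"
    using ctx q by (rule Var_ty)
  moreover have "\<Gamma> \<turnstile> Var i \<^bold>\<rightarrow> Trunc (Var k \<^bold>\<cdot> Var j) \<^bold>= Var i \<^bold>\<rightarrow> ?d \<^bold>\<cdot> Var j ty"
    using ctx D X Y by (intro eqty_sym[OF arr_trunc_fam_eq]) (simp_all add: ty_rules)
  ultimately have q': "\<Gamma> \<turnstile> Var q \<^bold>: Var i \<^bold>\<rightarrow> ?d \<^bold>\<cdot> Var j" by (rule tm_conv)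
  have "\<Gamma> \<turnstile> Var c \<^bold>\<cdot> Var i \<^bold>\<cdot> Var j \<^bold>\<cdot> Tr (Var a) \<^bold>\<cdot> Var q \<^bold>: ?d \<^bold>\<cdot> ?T"
    using ctx dom X Y
    by (intro cond_conjD[OF _ _ _ a' q'] Var_ty) (simp_all add: dominance_axiom_def)
  moreover have "\<Gamma> \<turnstile> ?d \<^bold>\<cdot> ?T \<^bold>= Trunc (Var k \<^bold>\<cdot> ?T) ty"
    using ctx D T by (intro eqty_El trunc_fam_App)
  ultimately have t: "\<Gamma> \<turnstile> Var c \<^bold>\<cdot> Var i \<^bold>\<cdot> Var j \<^bold>\<cdot> Tr (Var a) \<^bold>\<cdot> Var q \<^bold>: Trunc (Var k \<^bold>\<cdot> ?T)"
    by (rule tm_conv)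
  have I: "?\<Delta> \<turnstile> Var (Suc i) ty" and \<Delta>': "?\<Delta>' ctx"
    using ctx D X T by (simp_all add: ty_rules)
  \<comment> \<open>Here \<open>Var 0\<close> is the point of \<open>X\<close> and
    \<open>Var 1\<close> the element of \<open>D (X \<times> Y)\<close> obtained by opening the
    truncation; abstracting the point gives the required function.\<close>
  then have "\<exists>t. ?\<Delta>' \<turnstile> t \<^bold>: Var (Suc (Suc k)) \<^bold>\<cdot> Var (Suc (Suc j))"
    using D pv X Y
    by (intro fam_of_times_prop_valued
          [where m = "Suc (Suc m)" and i = "Suc (Suc i)" and x = 0 and e = 1]) simp_all
  then have "\<exists>t. ?\<Delta> \<turnstile> t \<^bold>: wk (Var i \<^bold>\<rightarrow> Var k \<^bold>\<cdot> Var j)"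
    using LamI_ex[OF I, of "Var (Suc k) \<^bold>\<cdot> Var (Suc j)"] by simp
  then have "\<exists>s. ?\<Delta> \<turnstile> s \<^bold>: Trunc (wk (Var i \<^bold>\<rightarrow> Var k \<^bold>\<cdot> Var j))"
    by (blast intro: tm_Tr)
  then show ?thesis
    using ctx D X Y by (intro Trunc_bind[OF ctx _ _ _ t]) (simp_all add: ty_rules)
qed

lemma dominance_imp_choice:
  assumes ctx: "\<Gamma> ctx"
    and D: "k < length \<Gamma>" "var_ty \<Gamma> k = U \<^bold>\<rightarrow> U"
    and pv: "m < length \<Gamma>" "var_ty \<Gamma> m = prop_valued (Var k)"
    and dom: "c < length \<Gamma>" "var_ty \<Gamma> c = dominance_axiom (trunc_fam (Var k))"
  shows "\<exists>t. \<Gamma> \<turnstile> t \<^bold>: choice_cond (Var k)"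
proof -
  let ?A = "Var (k + 2) \<^bold>\<cdot> Var 1" and ?B = "Var 1 \<^bold>\<rightarrow> Trunc (Var (k + 2) \<^bold>\<cdot> Var 0)"
  have A: "U # U # \<Gamma> \<turnstile> ?A ty" and B: "?A # U # U # \<Gamma> \<turnstile> wk ?B ty"
    using ctx D by (simp_all add: ty_rules)
  then have "(wk ?B # ?A # U # U # \<Gamma>) ctx" using ctx by (intro ctx_Cons ty_U)
  then have "\<exists>t. wk ?B # ?A # U # U # \<Gamma> \<turnstile> t \<^bold>: Trunc (Var 3 \<^bold>\<rightarrow> Var (k + 4) \<^bold>\<cdot> Var 2)"
    using D pv dom
    by (intro choice_of_dominance[where m = "m + 4" and c = "c + 4" and a = 1 and q = 0])
      (simp_all add: eval_nat_numeral)
  then show ?thesis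
    unfolding choice_cond_def Let_def using ctx A B
    by (intro PiPi_arr_arrI) (simp_all add: eval_nat_numeral)
qed

(* context, most recent first: D : U -> U, then (a) about D = Var 0, then (b) about D = Var 1 *)
theorem theorem5p32:
  "\<exists>t. [cond_conj (Var 1), prop_valued (Var 0), U \<^bold>\<rightarrow> U]
         \<turnstile> t \<^bold>: choice_cond (Var 2) \<^bold>\<leftrightarrow> dominance_axiom (trunc_fam (Var 2))"
proof -
  let ?\<Gamma> = "[cond_conj (Var 1), prop_valued (Var 0), U \<^bold>\<rightarrow> U]"
  let ?A = "choice_cond (Var 2)" and ?B = "dominance_axiom (trunc_fam (Var 2))"
  have ctx: "?\<Gamma> ctx"
    by (simp add: ctx_Nil ty_rules prop_valued_ty cond_conj_ty)
  have A: "?\<Gamma> \<turnstile> ?A ty" and B: "?\<Gamma> \<turnstile> ?B ty"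
    using ctx by (simp_all add: choice_cond_ty dominance_axiom_ty numeral_2_eq_2)
  \<comment> \<open>The indices 3, 1 and 0 pick out \<open>D\<close>, conditional conjunction and
    the assumed choice condition.\<close>
  have "\<exists>t. ?A # ?\<Gamma> \<turnstile> t \<^bold>: wk ?B"
    using choice_imp_dominance[of "?A # ?\<Gamma>" 3 1 0] ctx A
    by (simp add: ctx_Cons numeral_2_eq_2 numeral_3_eq_3)
  then obtain s where s: "?\<Gamma> \<turnstile> s \<^bold>: ?A \<^bold>\<rightarrow> ?B"
    using LamI_ex[OF A] by blast
  \<comment> \<open>This direction draws on index 2, the map from \<open>D X\<close> to
    propositionality of \<open>X\<close>, in place of conditional conjunction.\<close>
  have "\<exists>t. ?B # ?\<Gamma> \<turnstile> t \<^bold>: wk ?A"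
    using dominance_imp_choice[of "?B # ?\<Gamma>" 3 2 0] ctx B
    by (simp add: ctx_Cons numeral_2_eq_2 numeral_3_eq_3)
  then obtain t where t: "?\<Gamma> \<turnstile> t \<^bold>: ?B \<^bold>\<rightarrow> ?A"
    using LamI_ex[OF B] by blast
  have "(?A \<^bold>\<rightarrow> ?B) # ?\<Gamma> \<turnstile> wk (?B \<^bold>\<rightarrow> ?A) ty"
    using ctx A B
    by (simp add: arr_ty ctx_Cons choice_cond_ty dominance_axiom_ty eval_nat_numeral)
  from PrI[OF this s t] show ?thesis unfolding iff_ty_def ..
qed

end
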